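(* Let $a_1,\ldots,a_m$ be distinct points in $\mathbb{R}^n$ and let $\varphi(x):=\sum_{i=1}^m\|x-a_i\|$ for $x\in\mathbb{R}^n$. Suppose that the points $a_1,\ldots,a_m$ do not all lie on the same line (i.e., they are not collinear). Then the function $\varphi$ is strictly convex on $\mathbb{R}^n$, and the Fermat-Torricelli problem "minimize $\varphi(x)$ subject to $x\in\mathbb{R}^n$" has a unique solution.
   Context: $\|\cdot\|$ denotes the Euclidean norm in $\mathbb{R}^n$. A function $f\colon\mathbb{R}^n\to\mathbb{R}$ is strictly convex if $f(\lambda x+(1-\lambda)y)<\lambda f(x)+(1-\lambda)f(y)$ for all $x\ne y$ in $\mathbb{R}^n$ and all $\lambda\in(0,1)$. For distinct $a,b\in\mathbb{R}^n$, the line containing $a$ and $b$ is $\{ta+(1-t)b\mid t\in\mathbb{R}\}$. A solution of the problem is a global minimizer of $\varphi$ over $\mathbb{R}^n$. *)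

theory Defs
  imports "HOL-Analysis.Analysis"
begin

definition strictly_convex :: "('a::real_vector \<Rightarrow> real) \<Rightarrow> bool" where
  "strictly_convex f \<longleftrightarrow>
    (\<forall>x y. \<forall>l\<in>{0<..<1}. x \<noteq> y \<longrightarrow>
      f (l *\<^sub>R x + (1 - l) *\<^sub>R y) < l * f x + (1 - l) * f y)"

definition sum_dist :: "nat \<Rightarrow> (nat \<Rightarrow> 'a::real_normed_vector) \<Rightarrow> 'a \<Rightarrow> real" where
  "sum_dist m a x = (\<Sum>i=1..m. norm (x - a i))"

text \<open>
  The library predicate \<^const>\<open>collinear\<close> also admits a degenerate (zero) direction. In a space of
  positive dimension this makes no difference: a set is collinear iff it is contained in a line
  through two distinct points.
\<close>

lemma collinear_iff_subset_line:
  fixes S :: "'a::euclidean_space set"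
  shows "collinear S \<longleftrightarrow> (\<exists>p q. p \<noteq> q \<and> S \<subseteq> {t *\<^sub>R p + (1 - t) *\<^sub>R q |t. True})"
proof
  assume "collinear S"
  then obtain u v where uv: "\<forall>x\<in>S. \<exists>c. x = u + c *\<^sub>R v"
    unfolding collinear_alt by blast
  obtain b :: 'a where b: "b \<noteq> 0"
    using nonzero_Basis nonempty_Basis by blast
  obtain w where w: "w \<noteq> 0" "\<forall>x\<in>S. \<exists>c. x = u + c *\<^sub>R w"
  proof (cases "v = 0")
    case True
    then have "\<forall>x\<in>S. \<exists>c. x = u + c *\<^sub>R b"
      using uv by (auto intro: exI[of _ 0])
    with b that show ?thesis by blast
  next
    case False
    with uv that show ?thesis by blast
  qed
  have "S \<subseteq> {t *\<^sub>R (u + w) + (1 - t) *\<^sub>R u |t. True}"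
  proof
    fix x assume "x \<in> S"
    then obtain c where "x = u + c *\<^sub>R w" using w by blast
    then have "x = c *\<^sub>R (u + w) + (1 - c) *\<^sub>R u"
      by (simp add: algebra_simps)
    then show "x \<in> {t *\<^sub>R (u + w) + (1 - t) *\<^sub>R u |t. True}" by blast
  qed
  moreover have "u + w \<noteq> u" using w by simp
  ultimately show "\<exists>p q. p \<noteq> q \<and> S \<subseteq> {t *\<^sub>R p + (1 - t) *\<^sub>R q |t. True}" by blast
next
  assume "\<exists>p q. p \<noteq> q \<and> S \<subseteq> {t *\<^sub>R p + (1 - t) *\<^sub>R q |t. True}"
  then obtain p q where pq: "S \<subseteq> {t *\<^sub>R p + (1 - t) *\<^sub>R q |t. True}" by blast
  have "\<exists>c. x = q + c *\<^sub>R (p - q)" if "x \<in> S" for x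
  proof -
    obtain t where "x = t *\<^sub>R p + (1 - t) *\<^sub>R q" using pq \<open>x \<in> S\<close> by blast
    then have "x = q + t *\<^sub>R (p - q)" by (simp add: algebra_simps)
    then show ?thesis by blast
  qed
  then show "collinear S" unfolding collinear_alt by blast
qed

end

theory Submission
  imports Defs
begin

text \<open>
  Each summand is convex by the triangle inequality, and equality at a proper convex combination of
  distinct points \<open>x\<close>, \<open>y\<close> forces \<open>x - a\<^sub>i\<close> and \<open>y - a\<^sub>i\<close> to point in the same direction, which puts
  \<open>a\<^sub>i\<close> on the line through \<open>x\<close> and \<open>y\<close>. Some \<open>a\<^sub>i\<close> avoids that line, so the sum is strictly convex.
  Since the sum dominates the distance to any single \<open>a\<^sub>i\<close>, its minimum over a large ball is global;
  strict convexity gives uniqueness.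
\<close>

lemma dist_convex_combination_le:
  fixes x y a :: "'a::real_normed_vector"
  assumes "0 \<le> l" "l \<le> 1"
  shows "norm (l *\<^sub>R x + (1 - l) *\<^sub>R y - a) \<le> l * norm (x - a) + (1 - l) * norm (y - a)"
proof -
  have "l *\<^sub>R x + (1 - l) *\<^sub>R y - a = l *\<^sub>R (x - a) + (1 - l) *\<^sub>R (y - a)"
    by (simp add: algebra_simps)
  also have "norm \<dots> \<le> norm (l *\<^sub>R (x - a)) + norm ((1 - l) *\<^sub>R (y - a))"
    by (rule norm_triangle_ineq)
  finally show ?thesis using assms by simp
qed

text \<open>In an inner product space, equality in the triangle inequality for \<open>u\<close> and
  \<open>v\<close> means \<open>norm u *\<^sub>R v = norm v *\<^sub>R u\<close>. After cancelling
  \<open>l * (1 - l)\<close>, this is a linear equation for \<open>a\<close>.\<close>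

lemma dist_convex_combination_eq_imp_line:
  fixes x y a :: "'a::real_inner"
  assumes "x \<noteq> y" "0 < l" "l < 1"
    and eq: "norm (l *\<^sub>R x + (1 - l) *\<^sub>R y - a) = l * norm (x - a) + (1 - l) * norm (y - a)"
  shows "\<exists>t. a = t *\<^sub>R x + (1 - t) *\<^sub>R y"
proof -
  define p q where "p = norm (x - a)" and "q = norm (y - a)"
  have "l *\<^sub>R x + (1 - l) *\<^sub>R y - a = l *\<^sub>R (x - a) + (1 - l) *\<^sub>R (y - a)"
    by (simp add: algebra_simps)
  with eq assms have "norm (l *\<^sub>R (x - a) + (1 - l) *\<^sub>R (y - a))
      = norm (l *\<^sub>R (x - a)) + norm ((1 - l) *\<^sub>R (y - a))"
    by simp
  then have "norm (l *\<^sub>R (x - a)) *\<^sub>R ((1 - l) *\<^sub>R (y - a))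
      = norm ((1 - l) *\<^sub>R (y - a)) *\<^sub>R (l *\<^sub>R (x - a))"
    by (simp only: norm_triangle_eq)
  then have "(l * p) *\<^sub>R ((1 - l) *\<^sub>R (y - a)) = ((1 - l) * q) *\<^sub>R (l *\<^sub>R (x - a))"
    using assms by (simp add: p_def q_def)
  then have "(l * (1 - l)) *\<^sub>R (p *\<^sub>R (y - a)) = (l * (1 - l)) *\<^sub>R (q *\<^sub>R (x - a))"
    by (simp add: mult_ac)
  then have same_direction: "p *\<^sub>R (y - a) = q *\<^sub>R (x - a)"
    using assms by (simp del: scaleR_scaleR)
  \<comment> \<open>If \<open>p = q\<close>, then \<open>p *\<^sub>R (y - x) = 0\<close>, so both
    distances vanish and \<open>x = a = y\<close>.\<close>
  have "p \<noteq> q"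
  proof
    assume "p = q"
    with same_direction \<open>x \<noteq> y\<close> have "p = 0" by simp
    with \<open>p = q\<close> \<open>x \<noteq> y\<close> show False by (simp add: p_def q_def)
  qed
  \<comment> \<open>Solving \<open>same_direction\<close> for \<open>a\<close> gives the
    coefficients \<open>- q / (p - q)\<close> of \<open>x\<close> and \<open>p / (p - q)\<close> of
    \<open>y\<close>, which sum to 1.\<close>
  define t where "t = - q / (p - q)"
  have t: "(p - q) * t = - q" "(p - q) * (1 - t) = p"
    using \<open>p \<noteq> q\<close> by (simp_all add: t_def field_simps)
  have "(p - q) *\<^sub>R a = p *\<^sub>R y - q *\<^sub>R x"
    using same_direction by (simp add: algebra_simps)
  also have "\<dots> = (p - q) *\<^sub>R (t *\<^sub>R x + (1 - t) *\<^sub>R y)"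
    by (simp only: scaleR_right_distrib scaleR_scaleR t) simp
  finally have "a = t *\<^sub>R x + (1 - t) *\<^sub>R y"
    using \<open>p \<noteq> q\<close> by simp
  then show ?thesis by blast
qed

lemma strictly_convex_sum_dist:
  fixes a :: "nat \<Rightarrow> 'a::euclidean_space"
  assumes "\<not> collinear (a ` {1..m})"
  shows "strictly_convex (sum_dist m a)"
  unfolding strictly_convex_def
proof (intro allI ballI impI)
  fix x y :: 'a and l :: real
  assume l: "l \<in> {0<..<1}" and "x \<noteq> y"
  let ?z = "l *\<^sub>R x + (1 - l) *\<^sub>R y"
  let ?g = "\<lambda>i. l * norm (x - a i) + (1 - l) * norm (y - a i)"
  obtain j where j: "j \<in> {1..m}" "\<nexists>t. a j = t *\<^sub>R x + (1 - t) *\<^sub>R y"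
    using assms \<open>x \<noteq> y\<close> unfolding collinear_iff_subset_line by blast
  have le: "norm (?z - a i) \<le> ?g i" for i
    using l by (intro dist_convex_combination_le) auto
  have "norm (?z - a j) \<noteq> ?g j"
    using dist_convex_combination_eq_imp_line[OF \<open>x \<noteq> y\<close>] l j(2) by auto
  with le[of j] have "norm (?z - a j) < ?g j" by simp
  then have "sum_dist m a ?z < (\<Sum>i=1..m. ?g i)"
    unfolding sum_dist_def using le j(1) by (intro sum_strict_mono_ex1) auto
  also have "\<dots> = l * sum_dist m a x + (1 - l) * sum_dist m a y"
    by (simp add: sum_dist_def sum.distrib sum_distrib_left)
  finally show "sum_dist m a ?z < l * sum_dist m a x + (1 - l) * sum_dist m a y" .
qed

text \<open>Two distinct minimizers have equal values, and their midpoint would have a smaller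
  one.\<close>

lemma strictly_convex_minimizer_unique:
  assumes "strictly_convex f" and "\<And>z. f x \<le> f z" and "\<And>z. f y \<le> f z"
  shows "x = y"
proof (rule ccontr)
  assume "x \<noteq> y"
  with assms(1) have "f ((1/2) *\<^sub>R x + (1 - 1/2) *\<^sub>R y) < (1/2) * f x + (1 - 1/2) * f y"
    unfolding strictly_convex_def by (metis greaterThanLessThan_iff half_gt_zero_iff field_sum_of_halves
        less_add_same_cancel1 zero_less_one)
  with assms(2)[of "(1/2) *\<^sub>R x + (1 - 1/2) *\<^sub>R y"] assms(3)[of x] show False by simp
qed

lemma sum_dist_attains_min:
  fixes a :: "nat \<Rightarrow> 'a::{real_normed_vector, heine_borel}"
  assumes "1 \<le> m"
  shows "\<exists>x. \<forall>z. sum_dist m a x \<le> sum_dist m a z"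
proof -
  let ?f = "sum_dist m a"
  \<comment> \<open>Since \<open>?f z\<close> is at least the distance from \<open>z\<close> to
    \<open>a 1\<close>, a point outside this ball has a value above \<open>?f (a 1)\<close>, hence
    above the minimum over the ball.\<close>
  let ?B = "cball (a 1) (?f (a 1))"
  have "continuous_on ?B ?f"
    unfolding sum_dist_def by (intro continuous_intros)
  moreover have center: "a 1 \<in> ?B"
    by (simp add: sum_dist_def sum_nonneg)
  ultimately obtain x where x: "\<forall>z\<in>?B. ?f x \<le> ?f z"
    using continuous_attains_inf[of ?B ?f] by auto
  have "?f x \<le> ?f z" for z
  proof (cases "z \<in> ?B")
    case False
    have "norm (z - a 1) \<le> ?f z"
      unfolding sum_dist_def using assms by (intro member_le_sum) auto
    with False have "?f (a 1) \<le> ?f z"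
      by (simp add: dist_norm norm_minus_commute)
    with x center show ?thesis by (meson order_trans)
  qed (use x in blast)
  then show ?thesis by blast
qed

theorem proposition2p3:
  fixes a :: "nat \<Rightarrow> real ^ 'n" and m :: nat
  assumes "inj_on a {1..m}"
    and "\<not> collinear (a ` {1..m})"
  shows "strictly_convex (sum_dist m a) \<and>
    (\<exists>!x. is_arg_min (sum_dist m a) (\<lambda>x. x \<in> UNIV) x)"
proof
  show convex: "strictly_convex (sum_dist m a)"
    using assms(2) by (rule strictly_convex_sum_dist)
  \<comment> \<open>For \<open>m = 0\<close> the set of points is empty, hence collinear.\<close>
  have "1 \<le> m"
    using assms(2) by (cases m) auto
  then show "\<exists>!x. is_arg_min (sum_dist m a) (\<lambda>x. x \<in> UNIV) x"
    using sum_dist_attains_min[of m a] strictly_convex_minimizer_unique[OF convex]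
    by (auto simp: is_arg_min_linorder)
qed

end
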